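(* Let $a,b,c>0$ be real numbers with $ab\neq 1$, let $k\in\mathbb{Z}$ and let $n\ge 0$ be an integer. Then for every real $x$, $$B^{(k)}_n(x;a,b,c)=\sum_{m=0}^{n}\frac{1}{(m+1)^k}\sum_{j=0}^{m}(-1)^j\binom{m}{j}\bigl(x\ln c-j\ln a-(j+1)\ln b\bigr)^n .$$
   Context: For $k\in\mathbb{Z}$, ${\rm Li}_k(z)=\sum_{m=1}^{\infty} z^m/m^k$ (for $|z|<1$, or as a formal power series). For $a,b,c>0$ with $ab\ne 1$ and real $x$, the generalized poly-Bernoulli polynomials with parameters $a,b,c$, denoted $B^{(k)}_n(x;a,b,c)$, are defined by the power series expansion around $t=0$ $$\frac{{\rm Li}_k(1-(ab)^{-t})}{b^t-a^{-t}}\,c^{xt}=\sum_{n=0}^{\infty}B^{(k)}_n(x;a,b,c)\frac{t^n}{n!}.$$ The singularity at $t=0$ on the left is removable. Convention: $0^0=1$. *)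

theory Defs
  imports Complex_Main
begin

definition polylog :: "int \<Rightarrow> real \<Rightarrow> real" where
  "polylog k z = (\<Sum>m. z ^ Suc m / real (Suc m) powi k)"

definition poly_bernoulli_gf :: "int \<Rightarrow> real \<Rightarrow> real \<Rightarrow> real \<Rightarrow> real \<Rightarrow> real \<Rightarrow> real" where
  "poly_bernoulli_gf k x a b c t =
     polylog k (1 - (a * b) powr (- t)) / (b powr t - a powr (- t)) * c powr (x * t)"

text \<open>
  \<open>poly_bernoulli k n x a b c\<close> is the number $B^{(k)}_n(x;a,b,c)$: the sequence picked out by the
  description operator is the one with
  \<open>poly_bernoulli_gf k x a b c t = (\<Sum>n. B n * t ^ n / fact n)\<close> on a punctured neighbourhood of \<open>0\<close>.
  The point \<open>t = 0\<close>, where the quotient is \<open>0 / 0 = 0\<close> in HOL, is excluded by the filter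
  \<open>at 0\<close>: this expresses that the singularity there is removed.
\<close>

definition poly_bernoulli :: "int \<Rightarrow> nat \<Rightarrow> real \<Rightarrow> real \<Rightarrow> real \<Rightarrow> real \<Rightarrow> real" where
  "poly_bernoulli k n x a b c =
     (THE B. \<forall>\<^sub>F t in at 0. (\<lambda>i. B i * t ^ i / fact i) sums poly_bernoulli_gf k x a b c t) n"

end

theory Submission
  imports Defs "HOL-Complex_Analysis.Complex_Analysis"
begin

text \<open>
  With \<open>u = 1 - (ab)\<^sup>-\<^sup>t\<close> the denominator \<open>b\<^sup>t - a\<^sup>-\<^sup>t\<close> equals \<open>b\<^sup>t u\<close>, so one factor \<open>u\<close> of the
  polylogarithm cancels and the generating function becomes \<open>\<Sum>m. u\<^sup>m e\<^sup>s\<^sup>t / (m + 1)\<^sup>k\<close> with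
  \<open>s = x ln c - ln b\<close>. Since \<open>u\<close> vanishes at \<open>0\<close>, this is a composition of power series, and
  only the terms with \<open>m \<le> n\<close> contribute to the coefficient of \<open>t\<^sup>n\<close>; expanding \<open>u\<^sup>m\<close>
  binomially turns each of them into a combination of exponentials.
\<close>

text \<open>Strong induction: once all lower coefficients vanish, dividing by \<open>x ^ n\<close>
  leaves a power series with constant term \<open>d n\<close> that sums to 0 near 0. Its limit at 0
  is both \<open>d n\<close> and 0. The value at \<open>x = 0\<close> itself is never
  consulted.\<close>

lemma powser_sums_zero_imp_coeff_zero:
  fixes d :: "nat \<Rightarrow> 'a::{real_normed_field,banach}"
  assumes "\<forall>\<^sub>F x in at 0. (\<lambda>n. d n * x ^ n) sums 0"
  shows "d n = 0"
proof (induction n rule: less_induct)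
  case (less n)
  from assms obtain r where r: "r > 0"
    and sums: "\<And>x. x \<noteq> 0 \<Longrightarrow> norm x < r \<Longrightarrow> (\<lambda>n. d n * x ^ n) sums 0"
    by (auto simp: eventually_at)
  \<comment> \<open>\<open>d (0 + n)\<close> is the constant term of the shifted series
    \<open>\<lambda>i. d (i + n)\<close>, kept in this form for unification.\<close>
  have "((\<lambda>_::'a. 0) \<longlongrightarrow> d (0 + n)) (at 0)"
  proof (rule powser_limit_0_strong[OF r])
    fix x :: 'a assume x: "x \<noteq> 0" "norm x < r"
    have "(\<lambda>i. d (i + n) * x ^ (i + n)) sums (0 - (\<Sum>i<n. d i * x ^ i))"
      using sums[OF x] by (subst sums_iff_shift) simp
    also have "(\<Sum>i<n. d i * x ^ i) = 0"
      using less by simp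
    finally have "(\<lambda>i. d (i + n) * x ^ (i + n) / x ^ n) sums 0"
      using sums_divide by fastforce
    thus "(\<lambda>i. d (i + n) * x ^ i) sums 0"
      using x by (simp add: power_add)
  qed
  thus ?case
    by (simp add: tendsto_const_iff)
qed

lemma powser_coeffs_unique:
  fixes f :: "'a::{real_normed_field,banach} \<Rightarrow> 'a"
  assumes "\<forall>\<^sub>F x in at 0. (\<lambda>n. p n * x ^ n) sums f x"
    and "\<forall>\<^sub>F x in at 0. (\<lambda>n. q n * x ^ n) sums f x"
  shows "p = q"
proof
  fix n
  have "\<forall>\<^sub>F x in at 0. (\<lambda>n. (p n - q n) * x ^ n) sums 0"
    using assms
  proof eventually_elim
    case (elim x)
    thus ?case
      using sums_diff[OF elim] by (simp add: algebra_simps)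
  qed
  from powser_sums_zero_imp_coeff_zero[OF this, of n] show "p n = q n"
    by simp
qed

text \<open>Uniqueness of coefficients on a punctured neighbourhood makes the description operator
  pick \<open>B\<close>, so exhibiting one valid expansion suffices.\<close>

lemma poly_bernoulli_eqI:
  assumes "\<forall>\<^sub>F t in at 0. (\<lambda>i. B i * t ^ i / fact i) sums poly_bernoulli_gf k x a b c t"
  shows "poly_bernoulli k n x a b c = B n"
proof -
  have "(THE B. \<forall>\<^sub>F t in at 0. (\<lambda>i. B i * t ^ i / fact i) sums poly_bernoulli_gf k x a b c t) = B"
  proof (rule the_equality)
    show "\<forall>\<^sub>F t in at 0. (\<lambda>i. B i * t ^ i / fact i) sums poly_bernoulli_gf k x a b c t"
      by (rule assms)
  next
    fix B' assume "\<forall>\<^sub>F t in at 0. (\<lambda>i. B' i * t ^ i / fact i) sums poly_bernoulli_gf k x a b c t"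
    hence "(\<lambda>i. B' i / fact i) = (\<lambda>i. B i / fact i)"
      using assms by (intro powser_coeffs_unique) simp_all
    thus "B' = B"
      by (simp add: fun_eq_iff)
  qed
  thus ?thesis
    by (simp add: poly_bernoulli_def)
qed

text \<open>Ratio test: consecutive quotients tend to \<open>1 powi k\<close>, which is 1 whatever
  the sign of \<open>k\<close>.\<close>

lemma conv_radius_powi_Suc:
  "conv_radius (\<lambda>m. of_real (1 / real (Suc m) powi k) :: 'a::{real_normed_field,banach}) = 1"
proof (rule conv_radius_ratio_limit_nonzero[of _ 1])
  have "(\<lambda>m. real (Suc (Suc m)) / real (Suc m)) \<longlonglongrightarrow> 1"
    using LIMSEQ_Suc[OF LIMSEQ_Suc_n_over_n] by simp
  hence "(\<lambda>m. (real (Suc (Suc m)) / real (Suc m)) powi k) \<longlonglongrightarrow> 1 powi k"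
    by (rule tendsto_power_int) simp
  thus "(\<lambda>m. norm (of_real (1 / real (Suc m) powi k) :: 'a) /
      norm (of_real (1 / real (Suc (Suc m)) powi k) :: 'a)) \<longlonglongrightarrow> 1"
    by (simp add: power_int_divide_distrib norm_divide norm_power_int del: of_nat_Suc)
qed (simp_all add: one_ereal_def)

lemma fps_one_minus_exp_power_mult_exp_nth:
  fixes L s :: "'a::field_char_0"
  shows "((1 - fps_exp (- L)) ^ m * fps_exp s) $ n =
    (\<Sum>j\<le>m. (-1) ^ j * of_nat (m choose j) * (s - of_nat j * L) ^ n) / fact n"
proof -
  \<comment> \<open>With the exponential as first summand, the binomial theorem gives it the power
    \<open>j\<close>, and the other factor is a power of 1.\<close>
  have "(1 - fps_exp (- L)) ^ m = (- fps_exp (- L) + 1) ^ m"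
    by simp
  also have "\<dots> = (\<Sum>j\<le>m. of_nat (m choose j) * ((-1) ^ j * fps_exp (- L) ^ j))"
    by (subst binomial_ring) (simp add: power_minus[of "fps_exp (- L)"])
  also have "\<dots> * fps_exp s =
      (\<Sum>j\<le>m. fps_const ((-1) ^ j * of_nat (m choose j)) * fps_exp (s - of_nat j * L))"
    unfolding sum_distrib_right
  proof (rule sum.cong)
    fix j
    have "fps_const ((-1) ^ j * of_nat (m choose j) :: 'a) = (-1) ^ j * of_nat (m choose j)"
      by (simp add: fps_of_nat flip: fps_const_mult fps_const_power fps_const_neg)
    moreover have "fps_exp (s - of_nat j * L) = fps_exp (- L) ^ j * fps_exp s"
      by (simp add: fps_exp_power_mult flip: fps_exp_add_mult)
    ultimately show "of_nat (m choose j) * ((-1) ^ j * fps_exp (- L) ^ j) * fps_exp s =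
        fps_const ((-1) ^ j * of_nat (m choose j)) * fps_exp (s - of_nat j * L)"
      by (simp only: mult_ac)
  qed simp
  finally show ?thesis
    by (simp add: fps_sum_nth sum_divide_distrib)
qed

text \<open>\<open>G ^ m\<close> has no terms below degree \<open>m\<close>, which truncates the
  composition.\<close>

lemma fps_compose_mult_nth:
  fixes F G H :: "'a::idom fps"
  assumes "G $ 0 = 0"
  shows "(fps_compose F G * H) $ n = (\<Sum>m\<le>n. F $ m * (G ^ m * H) $ n)"
proof -
  \<comment> \<open>The bound \<open>n\<close> instead of \<open>i\<close> only adds zero terms, and
    makes the range independent of \<open>i\<close> so that the sums can be swapped.\<close>
  have 1: "fps_compose F G $ i = (\<Sum>m\<le>n. F $ m * G ^ m $ i)" if "i \<le> n" for i
    unfolding fps_compose_nth using that startsby_zero_power_prefix[OF assms]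
    by (intro sum.mono_neutral_left) auto
  have "(fps_compose F G * H) $ n = (\<Sum>i=0..n. \<Sum>m\<le>n. F $ m * (G ^ m $ i * H $ (n - i)))"
    by (simp add: fps_mult_nth 1 sum_distrib_right mult.assoc)
  also have "\<dots> = (\<Sum>m\<le>n. F $ m * (G ^ m * H) $ n)"
    by (subst sum.swap) (simp add: fps_mult_nth sum_distrib_left)
  finally show ?thesis .
qed

lemma has_fps_expansion_imp_eventually_sums:
  assumes "f has_fps_expansion F"
  shows "\<forall>\<^sub>F z in nhds 0. (\<lambda>n. F $ n * z ^ n) sums f z"
proof -
  have "\<forall>\<^sub>F z in nhds 0. z \<in> eball 0 (fps_conv_radius F)"
    using assms by (intro eventually_nhds_in_open) (auto simp: has_fps_expansion_def zero_ereal_def)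
  moreover have "\<forall>\<^sub>F z in nhds 0. eval_fps F z = f z"
    using assms by (simp add: has_fps_expansion_def)
  ultimately show ?thesis
  proof eventually_elim
    case (elim z)
    thus ?case
      using summable_sums[OF summable_fps[of z F]] by (simp add: eval_fps_def)
  qed
qed

lemma polylog_eq_mult:
  assumes "\<bar>u\<bar> < 1"
  shows "polylog k u = u * (\<Sum>m. 1 / real (Suc m) powi k * u ^ m)"
    and "summable (\<lambda>m. 1 / real (Suc m) powi k * u ^ m)"
proof -
  show summ: "summable (\<lambda>m. 1 / real (Suc m) powi k * u ^ m)"
    using assms conv_radius_powi_Suc[of k, where ?'a = real]
    by (intro summable_in_conv_radius) (simp_all add: one_ereal_def)
  show "polylog k u = u * (\<Sum>m. 1 / real (Suc m) powi k * u ^ m)"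
    unfolding polylog_def by (subst suminf_mult[OF summ, symmetric]) (simp add: field_simps)
qed

text \<open>The cancellation of \<open>u\<close> is legitimate because
  \<open>a * b \<noteq> 1\<close> and \<open>t \<noteq> 0\<close> force
  \<open>u \<noteq> 0\<close>.\<close>

lemma poly_bernoulli_gf_eq:
  assumes "a > 0" "b > 0" "c > 0" "a * b \<noteq> 1" "t \<noteq> 0"
  assumes "u = 1 - exp (- ln (a * b) * t)" "\<bar>u\<bar> < 1"
  shows "poly_bernoulli_gf k x a b c t =
    (\<Sum>m. 1 / real (Suc m) powi k * u ^ m) * exp ((x * ln c - ln b) * t)"
proof -
  have ab: "(a * b) powr (- t) = 1 - u"
    using assms by (simp add: powr_def)
  have u0: "u \<noteq> 0"
    using assms by (auto simp: ln_eq_zero_iff)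
  have denom: "b powr t - a powr (- t) = exp (t * ln b) * u"
  proof -
    have "exp (t * ln b) * u = exp (t * ln b) - exp (t * ln b + (- ln (a * b) * t))"
      by (simp only: assms(6) exp_add right_diff_distrib mult_1_right)
    also have "t * ln b + (- ln (a * b) * t) = - t * ln a"
      using assms by (simp add: ln_mult algebra_simps)
    finally show ?thesis
      using assms by (simp add: powr_def)
  qed
  have "poly_bernoulli_gf k x a b c t =
      (u * (\<Sum>m. 1 / real (Suc m) powi k * u ^ m)) / (exp (t * ln b) * u) * exp (x * t * ln c)"
    using assms polylog_eq_mult(1)[OF assms(7)] unfolding poly_bernoulli_gf_def ab denom
    by (simp add: powr_def)
  also have "\<dots> = (\<Sum>m. 1 / real (Suc m) powi k * u ^ m) * (exp (x * t * ln c) / exp (t * ln b))"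
    using u0 by simp
  also have "exp (x * t * ln c) / exp (t * ln b) = exp ((x * ln c - ln b) * t)"
    by (simp add: algebra_simps flip: exp_diff)
  finally show ?thesis .
qed

theorem corollary2p2:
  fixes a b c x :: real and k :: int and n :: nat
  assumes "a > 0" and "b > 0" and "c > 0" and "a * b \<noteq> 1"
  shows "poly_bernoulli k n x a b c =
    (\<Sum>m = 0..n. 1 / real (m + 1) powi k *
      (\<Sum>j = 0..m. (-1) ^ j * real (m choose j) *
        (x * ln c - real j * ln a - real (j + 1) * ln b) ^ n))"
proof -
  define L s where "L = ln (a * b)" and "s = x * ln c - ln b"
  \<comment> \<open>\<open>P\<close> is the series of \<open>Li_k(z) / z\<close>, and
    \<open>U\<close> that of \<open>u\<close> as a function of \<open>t\<close>. Both are complex,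
    so that expansions of analytic functions can be composed; the result is restricted to real
    \<open>t\<close> afterwards.\<close>
  define P :: "complex fps" where "P = Abs_fps (\<lambda>m. of_real (1 / real (Suc m) powi k))"
  define U :: "complex fps" where "U = 1 - fps_exp (- of_real L)"
  define B where "B n = (\<Sum>m = 0..n. 1 / real (m + 1) powi k *
      (\<Sum>j = 0..m. (-1) ^ j * real (m choose j) *
        (x * ln c - real j * ln a - real (j + 1) * ln b) ^ n))" for n
  have coeff: "(fps_compose P U * fps_exp (of_real s)) $ n = of_real (B n / fact n)" for n
  proof -
    \<comment> \<open>One of the \<open>j + 1\<close> copies of \<open>ln b\<close> goes into
      \<open>s\<close>; the other \<open>j\<close> pair with those of \<open>ln a\<close> to give
      \<open>j * L\<close>.\<close>
    have base: "x * ln c - real j * ln a - real (j + 1) * ln b = s - real j * L" for j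
      using assms by (simp add: L_def s_def ln_mult algebra_simps)
    have "(fps_compose P U * fps_exp (of_real s)) $ n =
        (\<Sum>m\<le>n. P $ m * (U ^ m * fps_exp (of_real s)) $ n)"
      by (rule fps_compose_mult_nth) (simp add: U_def)
    also have "\<dots> = of_real (B n / fact n)"
      unfolding U_def fps_one_minus_exp_power_mult_exp_nth B_def base
      by (simp add: P_def atLeast0AtMost sum_divide_distrib mult.commute)
    finally show ?thesis .
  qed
  have "eval_fps P has_fps_expansion P"
    by (rule eval_fps_has_fps_expansion)
       (simp add: P_def fps_conv_radius_def conv_radius_powi_Suc
          del: of_real_divide of_real_power_int of_nat_Suc)
  moreover have "(\<lambda>z. 1 - exp (- of_real L * z)) has_fps_expansion U"
    unfolding U_def by (intro fps_expansion_intros)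
  moreover have "U $ 0 = 0"
    by (simp add: U_def)
  ultimately have "(\<lambda>z. (eval_fps P \<circ> (\<lambda>z. 1 - exp (- of_real L * z))) z * exp (of_real s * z))
      has_fps_expansion fps_compose P U * fps_exp (of_real s)"
    by (intro has_fps_expansion_mult has_fps_expansion_compose has_fps_expansion_exp)
  hence sums: "\<forall>\<^sub>F z in nhds 0. (\<lambda>n. of_real (B n / fact n) * z ^ n) sums
      (eval_fps P (1 - exp (- of_real L * z)) * exp (of_real s * z))"
    using has_fps_expansion_imp_eventually_sums coeff by fastforce
  have "filterlim complex_of_real (nhds 0) (at 0)"
    using tendsto_of_real[OF tendsto_ident_at, of 0 UNIV] by simp
  hence "\<forall>\<^sub>F t in at 0. (\<lambda>n. of_real (B n / fact n) * complex_of_real t ^ n) sums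
      (eval_fps P (1 - exp (- of_real L * of_real t)) * exp (of_real s * of_real t))"
    by (rule eventually_compose_filterlim[OF sums])
  \<comment> \<open>By continuity, \<open>u\<close> stays inside the unit disc for small
    \<open>t\<close>, where the real series for the polylogarithm converges.\<close>
  moreover have "((\<lambda>t. \<bar>1 - exp (- L * t)\<bar>) \<longlongrightarrow> \<bar>1 - exp (- L * 0)\<bar>) (at 0)"
    by (intro tendsto_intros)
  hence "\<forall>\<^sub>F t in at 0. \<bar>1 - exp (- L * t)\<bar> < 1"
    by (rule order_tendstoD) simp
  moreover have "\<forall>\<^sub>F t in at (0::real). t \<noteq> 0"
    by (simp add: eventually_at_filter)
  ultimately have "\<forall>\<^sub>F t in at 0. (\<lambda>i. B i * t ^ i / fact i) sums poly_bernoulli_gf k x a b c t"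
  proof eventually_elim
    case (elim t)
    define u where "u = 1 - exp (- L * t)"
    have "eval_fps P (of_real u) = (\<Sum>m. of_real (1 / real (Suc m) powi k * u ^ m))"
      by (simp add: eval_fps_def P_def)
    \<comment> \<open>Pulling \<open>of_real\<close> out of the infinite sum needs convergence of
      the real series.\<close>
    also have "\<dots> = of_real (\<Sum>m. 1 / real (Suc m) powi k * u ^ m)"
      using polylog_eq_mult(2)[of u k] elim(2) by (intro suminf_of_real[symmetric]) (simp add: u_def)
    finally have "eval_fps P (1 - exp (- of_real L * of_real t)) * exp (of_real s * of_real t) =
        of_real ((\<Sum>m. 1 / real (Suc m) powi k * u ^ m) * exp (s * t))"
      by (simp add: u_def exp_of_real flip: of_real_mult of_real_minus)
    also have "(\<Sum>m. 1 / real (Suc m) powi k * u ^ m) * exp (s * t) = poly_bernoulli_gf k x a b c t"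
      using poly_bernoulli_gf_eq[OF assms elim(3), of u k x] elim(2) by (simp add: u_def L_def s_def)
    finally have "(\<lambda>n. complex_of_real (B n / fact n * t ^ n)) sums
        of_real (poly_bernoulli_gf k x a b c t)"
      using elim(1) by simp
    thus ?case
      by (subst (asm) sums_of_real_iff) simp
  qed
  from poly_bernoulli_eqI[OF this] show ?thesis
    by (simp only: B_def)
qed

end
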